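(* The BTL and Thurstone models are special cases of the FLR (feature low rank) model under the logit and probit links respectively. That is: (a) if $\mathbf{v}\in\mathbb{R}^n$ has positive entries and $P_{ij}=\frac{v_i}{v_i+v_j}$ for all $i,j\in[n]$, then $\mathbf{P}$ is an FLR preference matrix under the logit link $\psi(x)=\log\frac{x}{1-x}$; (b) if $\mathbf{s}\in\mathbb{R}^n$ and $P_{ij}=\Phi(s_i-s_j)$ for all $i,j\in[n]$, where $\Phi$ is the standard normal CDF, then $\mathbf{P}$ is an FLR preference matrix under the probit link $\psi=\Phi^{-1}$.
   Context: A preference matrix over $n$ items is $\mathbf{P}\in[0,1]^{n\times n}$ with $P_{ij}+P_{ji}=1$ for all $i,j$. A preference matrix $\mathbf{P}$ with entries in $(0,1)$ is an FLR preference matrix under a link function $\psi:(0,1)\to\mathbb{R}$ if there are $d\ge1$, feature vectors $\mathbf{f}_1,\dots,\mathbf{f}_n\in\mathbb{R}^d$, and parameters $\mathbf{w}\in\mathbb{R}^d$, $\mathbf{W}\in\mathbb{R}^{d\times d}$ such that, with energies $E_{ij}=\mathbf{f}_i^\top\mathbf{w}+\mathbf{f}_i^\top\mathbf{W}\mathbf{f}_j$, one has $\psi(P_{ij})=E_{ji}-E_{ij}$ for all $i,j$. (For $\psi=$ logit this is $P_{ij}=\frac{e^{-E_{ij}}}{e^{-E_{ij}}+e^{-E_{ji}}}$.) *)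

theory Defs
  imports "HOL-Probability.Characteristic_Functions" "Jordan_Normal_Form.Matrix"
begin

text \<open>
  Items are numbered \<open>0, \<dots>, n - 1\<close>. The number of features \<open>d\<close> is bound by an existential
  quantifier, so vectors and matrices are the ones with carriers from \<^theory>\<open>Jordan_Normal_Form.Matrix\<close>.
  The competing notation from the analysis library for \<open>$\<close> and \<open>\<bullet>\<close> is switched off.
\<close>

unbundle no vec_syntax
unbundle no inner_syntax

definition preference_matrix :: "nat \<Rightarrow> real mat \<Rightarrow> bool" where
  "preference_matrix n P \<longleftrightarrow>
     P \<in> carrier_mat n n \<and>
     (\<forall>i<n. \<forall>j<n. 0 \<le> P $$ (i, j) \<and> P $$ (i, j) \<le> 1) \<and>
     (\<forall>i<n. \<forall>j<n. P $$ (i, j) + P $$ (j, i) = 1)"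

definition flr_energy :: "(nat \<Rightarrow> real vec) \<Rightarrow> real vec \<Rightarrow> real mat \<Rightarrow> nat \<Rightarrow> nat \<Rightarrow> real" where
  "flr_energy f w W i j = f i \<bullet> w + f i \<bullet> (W *\<^sub>v f j)"

text \<open>
  A link function has domain \<open>(0, 1)\<close>. It is modelled as a total function, and only its values on
  that interval are used, because the entries of \<open>P\<close> are required to lie there.
\<close>

definition flr_preference_matrix :: "(real \<Rightarrow> real) \<Rightarrow> nat \<Rightarrow> real mat \<Rightarrow> bool" where
  "flr_preference_matrix \<psi> n P \<longleftrightarrow>
     preference_matrix n P \<and>
     (\<forall>i<n. \<forall>j<n. 0 < P $$ (i, j) \<and> P $$ (i, j) < 1) \<and>
     (\<exists>d\<ge>1. \<exists>f w W.
        (\<forall>i<n. f i \<in> carrier_vec d) \<and> w \<in> carrier_vec d \<and> W \<in> carrier_mat d d \<and>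
        (\<forall>i<n. \<forall>j<n. \<psi> (P $$ (i, j)) = flr_energy f w W j i - flr_energy f w W i j))"

definition logit :: "real \<Rightarrow> real" where
  "logit x = ln (x / (1 - x))"

definition std_normal_cdf :: "real \<Rightarrow> real" where
  "std_normal_cdf = cdf std_normal_distribution"

text \<open>
  The range of the normal distribution function is \<open>(0, 1)\<close>, so \<open>probit\<close> is meaningful exactly there.
  The usual notation \<open>inv\<close> for \<^term>\<open>inv_into UNIV\<close> is taken by group inverses here.
\<close>

definition probit :: "real \<Rightarrow> real" where
  "probit = inv_into UNIV std_normal_cdf"

end

theory Submission
  imports Defs
begin

text \<open>In both models the link turns a preference probability into a difference of scores:
  \<open>ln (v $ i) - ln (v $ j)\<close> under logit, \<open>s $ i - s $ j\<close> under probit. Any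
  such difference is an FLR energy difference with a single feature and no interaction term, which
  is \<open>flr_preference_matrix_score_difference\<close>. The BTL case then rests on
  \<open>logit_ratio\<close>. The Thurstone case rests on three facts about the normal CDF: it is
  positive, it satisfies the reflection identity \<open>std_normal_cdf_uminus\<close>, and it is
  injective, so that probit undoes it.\<close>

lemma flr_preference_matrix_score_difference:
  fixes u :: "nat \<Rightarrow> real"
  assumes "P \<in> carrier_mat n n"
    and pos: "\<And>i j. i < n \<Longrightarrow> j < n \<Longrightarrow> 0 < P $$ (i, j)"
    and sum: "\<And>i j. i < n \<Longrightarrow> j < n \<Longrightarrow> P $$ (i, j) + P $$ (j, i) = 1"
    and link: "\<And>i j. i < n \<Longrightarrow> j < n \<Longrightarrow> \<psi> (P $$ (i, j)) = u i - u j"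
  shows "flr_preference_matrix \<psi> n P"
proof -
  \<comment> \<open>The upper bound is the positivity of the transposed entry.\<close>
  have lt1: "P $$ (i, j) < 1" if "i < n" "j < n" for i j
    using pos[of j i] sum[of i j] that by linarith
  \<comment> \<open>The link value is the energy of \<open>(j, i)\<close> minus that of
    \<open>(i, j)\<close>, so item \<open>i\<close> must have energy \<open>- u i\<close>: a high
    score is a low energy. With \<open>W = 0\<close> the energy depends on its first index
    only.\<close>
  define f where "f i = vec 1 (\<lambda>_. - u i)" for i
  define w :: "real vec" where "w = vec 1 (\<lambda>_. 1)"
  define W :: "real mat" where "W = 0\<^sub>m 1 1"
  have "flr_energy f w W i j = - u i" for i j
    by (simp add: flr_energy_def f_def w_def W_def scalar_prod_def)
  then have "\<forall>i<n. \<forall>j<n. \<psi> (P $$ (i, j)) = flr_energy f w W j i - flr_energy f w W i j"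
    by (simp add: link)
  moreover have "\<forall>i<n. f i \<in> carrier_vec 1" "w \<in> carrier_vec 1" "W \<in> carrier_mat 1 1"
    by (simp_all add: f_def w_def W_def)
  ultimately have "\<exists>d\<ge>1. \<exists>f w W.
        (\<forall>i<n. f i \<in> carrier_vec d) \<and> w \<in> carrier_vec d \<and> W \<in> carrier_mat d d \<and>
        (\<forall>i<n. \<forall>j<n. \<psi> (P $$ (i, j)) = flr_energy f w W j i - flr_energy f w W i j)"
    by blast
  moreover have "preference_matrix n P"
    using assms(1) pos sum lt1 by (simp add: preference_matrix_def less_imp_le)
  ultimately show ?thesis
    using pos lt1 by (simp add: flr_preference_matrix_def)
qed

lemma logit_ratio:
  assumes "0 < a" "0 < b"
  shows "logit (a / (a + b)) = ln a - ln b"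
proof -
  have "1 - a / (a + b) = b / (a + b)"
    using assms by (simp add: field_simps)
  then have "a / (a + b) / (1 - a / (a + b)) = a / b"
    using assms by simp
  then show ?thesis
    using assms by (simp add: logit_def ln_div)
qed

interpretation std_normal: real_distribution std_normal_distribution
  by (rule real_dist_normal_dist)

text \<open>The increment of the CDF is the mass of \<open>{x<..y}\<close>. The density is positive
  everywhere, so this mass could vanish only if the interval had Lebesgue measure zero.\<close>

lemma strict_mono_std_normal_cdf: "strict_mono std_normal_cdf"
proof (rule strict_monoI)
  fix x y :: real
  assume "x < y"
  have "{x<..y} \<notin> null_sets std_normal_distribution"
  proof
    assume "{x<..y} \<in> null_sets std_normal_distribution"
    then have "AE t in lborel. t \<notin> {x<..y}"
      using normal_density_pos[of 1 0] by (subst (asm) null_sets_density_iff) (auto simp: less_le)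
    then have "{x<..y} \<in> null_sets lborel"
      by (simp add: AE_iff_null_sets)
    then have "emeasure lborel {x<..y} = 0"
      by (rule null_setsD1)
    with \<open>x < y\<close> show False by simp
  qed
  then have "measure std_normal_distribution {x<..y} \<noteq> 0"
    by (auto simp: null_sets_def std_normal.emeasure_eq_measure)
  then have "0 < cdf std_normal_distribution y - cdf std_normal_distribution x"
    using \<open>x < y\<close> by (simp add: std_normal.cdf_diff_eq zero_less_measure_iff)
  then show "std_normal_cdf x < std_normal_cdf y"
    by (simp add: std_normal_cdf_def)
qed

text \<open>Strict growth from \<open>x - 1\<close> to \<open>x\<close> lifts the value above a
  nonnegative one.\<close>

lemma std_normal_cdf_pos: "0 < std_normal_cdf x"
  using strict_monoD[OF strict_mono_std_normal_cdf, of "x - 1" x]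
    std_normal.cdf_nonneg[of "x - 1"]
  by (simp add: std_normal_cdf_def)

text \<open>The density is even, so the lower tail at \<open>- x\<close> has the same mass as the
  upper tail at \<open>x\<close>, which complements \<open>{..x}\<close>.\<close>

lemma std_normal_cdf_uminus: "std_normal_cdf x + std_normal_cdf (- x) = 1"
proof -
  have "emeasure std_normal_distribution {..- x} = (\<integral>\<^sup>+t. ennreal (std_normal_density t) * indicator {..- x} t \<partial>lborel)"
    by (subst emeasure_density) auto
  \<comment> \<open>Substitution of \<open>- t\<close> for \<open>t\<close>.\<close>
  also have "\<dots> = (\<integral>\<^sup>+t. ennreal (std_normal_density t) * indicator {x..} t \<partial>lborel)"
    by (subst nn_integral_real_affine[where c = "-1" and t = 0])
      (auto simp: normal_density_def indicator_def intro!: nn_integral_cong)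
  \<comment> \<open>The endpoint \<open>x\<close> is a Lebesgue null set; dropping it leaves the
    exact complement of \<open>{..x}\<close>.\<close>
  also have "\<dots> = (\<integral>\<^sup>+t. ennreal (std_normal_density t) * indicator {x<..} t \<partial>lborel)"
    using AE_lborel_singleton[of x]
    by (intro nn_integral_cong_AE) (auto elim!: eventually_mono simp: indicator_def)
  also have "\<dots> = emeasure std_normal_distribution {x<..}"
    by (subst emeasure_density) auto
  finally have "std_normal_cdf (- x) = measure std_normal_distribution {x<..}"
    by (simp add: std_normal_cdf_def cdf_def measure_def)
  also have "{x<..} = space std_normal_distribution - {..x}"
    by auto
  also have "measure std_normal_distribution \<dots> = 1 - std_normal_cdf x"
    by (subst std_normal.prob_compl) (auto simp: std_normal_cdf_def cdf_def)
  finally show ?thesis by simp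
qed

text \<open>Injectivity makes \<open>inv_into UNIV\<close> a left inverse, and Thurstone entries are
  values of the CDF by assumption.\<close>

lemma probit_std_normal_cdf: "probit (std_normal_cdf x) = x"
  unfolding probit_def
  by (rule inv_f_f) (rule strict_mono_imp_inj_on[OF strict_mono_std_normal_cdf])

theorem corollary2:
  fixes n :: nat and P :: "real mat"
  assumes "P \<in> carrier_mat n n"
  shows "(\<forall>v \<in> carrier_vec n.
            (\<forall>i<n. 0 < v $ i) \<longrightarrow>
            (\<forall>i<n. \<forall>j<n. P $$ (i, j) = v $ i / (v $ i + v $ j)) \<longrightarrow>
            flr_preference_matrix logit n P) \<and>
         (\<forall>s \<in> carrier_vec n.
            (\<forall>i<n. \<forall>j<n. P $$ (i, j) = std_normal_cdf (s $ i - s $ j)) \<longrightarrow>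
            flr_preference_matrix probit n P)"
proof (intro conjI ballI impI)
  fix v :: "real vec"
  assume v: "\<forall>i<n. 0 < v $ i" and P: "\<forall>i<n. \<forall>j<n. P $$ (i, j) = v $ i / (v $ i + v $ j)"
  show "flr_preference_matrix logit n P"
  proof (rule flr_preference_matrix_score_difference[where u = "\<lambda>i. ln (v $ i)"])
    fix i j
    assume ij: "i < n" "j < n"
    then have pos: "0 < v $ i" "0 < v $ j"
      using v by auto
    show "0 < P $$ (i, j)"
      using P ij pos by simp
    show "P $$ (i, j) + P $$ (j, i) = 1"
      using P ij pos by (simp add: add_divide_distrib[symmetric] add.commute)
    show "logit (P $$ (i, j)) = ln (v $ i) - ln (v $ j)"
      using P ij pos by (simp add: logit_ratio)
  qed fact
next
  fix s :: "real vec"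
  assume P: "\<forall>i<n. \<forall>j<n. P $$ (i, j) = std_normal_cdf (s $ i - s $ j)"
  show "flr_preference_matrix probit n P"
  proof (rule flr_preference_matrix_score_difference[where u = "\<lambda>i. s $ i"])
    fix i j
    assume ij: "i < n" "j < n"
    show "0 < P $$ (i, j)"
      using P ij by (simp add: std_normal_cdf_pos)
    show "P $$ (i, j) + P $$ (j, i) = 1"
      using P ij std_normal_cdf_uminus[of "s $ i - s $ j"] by simp
    show "probit (P $$ (i, j)) = s $ i - s $ j"
      using P ij by (simp add: probit_std_normal_cdf)
  qed fact
qed

end
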